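(* Let $s\geqslant 2$ and $n\geqslant 1$ be integers. Let $M_n$ be the multiset $\{\underbrace{1,\ldots,1}_{s-1},\underbrace{2,\ldots,2}_{s-1},\ldots,\underbrace{n-1,\ldots,n-1}_{s-1},n\}$, in which each of $1,\ldots,n-1$ occurs with multiplicity $s-1$ and $n$ occurs once. Let $\mathcal{A}^{(s-1)}_n$ be the collection of sub-multisets $A$ of $M_n$ such that $n\in A$ and $\min A\geqslant |A|$. Then $|\mathcal{A}^{(s-1)}_n| = F^{(s)}_n$.
   Context: Sub-multisets are counted as multisets (copies of the same integer are indistinguishable), and $|A|$ denotes the size of $A$ counted with multiplicity. The $s$-step Fibonacci sequence is defined by $F^{(s)}_{2-s}=\cdots=F^{(s)}_0=0$, $F^{(s)}_1=1$, and $F^{(s)}_n=F^{(s)}_{n-1}+\cdots+F^{(s)}_{n-s}$ for $n\geqslant 2$. *)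

theory Defs
  imports "HOL-Library.Multiset"
begin

(* Indices are integers because the initial values sit at 2 - s, ..., 0.  Below 2 - s
   the sequence is undefined in the source; the value 0 there is a totalisation that the
   recurrence (used for n >= 2 only, hence never reaching below 2 - s) does not see. *)
function sfib :: "nat \<Rightarrow> int \<Rightarrow> nat" where
  "sfib s n =
     (if n \<le> 0 then 0
      else if n = 1 then 1
      else (\<Sum>i\<in>{1..s}. sfib s (n - int i)))"
  by pat_completeness auto
termination
  by (relation "Wellfounded.measure (\<lambda>(s, n). nat n)") auto

declare sfib.simps [simp del]

lemma sfib_nonpos: "n \<le> 0 \<Longrightarrow> sfib s n = 0"
  by (simp add: sfib.simps)

lemma sfib_1: "sfib s 1 = 1"
  by (simp add: sfib.simps)

lemma sfib_rec: "n \<ge> 2 \<Longrightarrow> sfib s n = (\<Sum>i\<in>{1..s}. sfib s (n - int i))"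
  by (subst sfib.simps) auto

definition ground_mset :: "nat \<Rightarrow> nat \<Rightarrow> nat multiset" where
  "ground_mset m n = (\<Sum>k\<in>{1..<n}. replicate_mset m k) + {#n#}"

lemma count_ground_mset:
  "count (ground_mset m n) k =
     (if 1 \<le> k \<and> k < n then m else if k = n then 1 else 0)"
proof -
  have "(\<Sum>j\<in>{1..<n}. count (replicate_mset m j) k) = (\<Sum>j\<in>{1..<n}. if j = k then m else 0)"
    by (rule sum.cong) auto
  also have "\<dots> = (if k \<in> {1..<n} then m else 0)"
    by (rule sum.delta) simp
  finally show ?thesis
    unfolding ground_mset_def by (simp add: count_sum)
qed

definition schreier_msets :: "nat \<Rightarrow> nat \<Rightarrow> nat multiset set" where
  "schreier_msets m n =
     {A. A \<subseteq># ground_mset m n \<and> n \<in># A \<and> Min (set_mset A) \<ge> size A}"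

end

(* Remove n from A and let B be the rest; sort the multisets B by the multiplicity j of n - 1 in B.
   Deleting these j copies and lowering all the other elements by j gives the corresponding
   multiset for n - 1 - j, because the size and the minimum drop by the same amount.  As j runs
   through 0, ..., s - 1, this is the s-step Fibonacci recurrence. *)
theory Submission
  imports Defs
begin

text \<open>These are the multisets left after removing the single \<open>n\<close>, with
  \<open>m\<close> in the role of s - 1. The strict \<open>size B < k\<close> accounts for the
  removed element, and the elementwise form covers the empty multiset without a minimum.\<close>

definition schreier_rest :: "nat \<Rightarrow> nat \<Rightarrow> nat multiset set" where
  "schreier_rest m n = {B. \<forall>k\<in>#B. k < n \<and> count B k \<le> m \<and> size B < k}"

lemma add_mset_mem_schreier_msets_iff:
  assumes "n \<ge> 1"
  shows "add_mset n B \<in> schreier_msets m n \<longleftrightarrow> B \<in> schreier_rest m n"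
proof
  assume A: "add_mset n B \<in> schreier_msets m n"
  then have sub: "count (add_mset n B) k \<le> count (ground_mset m n) k" for k
    by (simp add: schreier_msets_def subseteq_mset_def)
  have "Suc (size B) \<le> k" if "k \<in># B" for k
  proof -
    have "Suc (size B) \<le> Min (set_mset (add_mset n B))"
      using A by (simp add: schreier_msets_def)
    also have "\<dots> \<le> k"
      using that by (intro Min_le) auto
    finally show ?thesis .
  qed
  moreover have "k < n \<and> count B k \<le> m" if "k \<in># B" for k
  proof -
    \<comment> \<open>This rules out \<open>k = n\<close>: a copy of \<open>n\<close> in
      \<open>B\<close> would give \<open>add_mset n B\<close> at least two copies, while the ground
      multiset has only one.\<close>
    have "count B k > 0"
      using that by simp
    with sub[of k] show ?thesis
      by (auto simp: count_ground_mset split: if_splits simp del: count_greater_zero_iff)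
  qed
  ultimately show "B \<in> schreier_rest m n"
    by (auto simp: schreier_rest_def Suc_le_eq)
next
  assume "B \<in> schreier_rest m n"
  then have B: "k < n \<and> count B k \<le> m \<and> size B < k" if "k \<in># B" for k
    using that by (simp add: schreier_rest_def)
  have "n \<notin># B"
    using B by blast
  then have "count (add_mset n B) k \<le> count (ground_mset m n) k" for k
  proof (cases "k \<in># B")
    case True
    then have "k < n" "count B k \<le> m" "1 \<le> k"
      using B[of k] by auto
    then show ?thesis
      by (simp add: count_ground_mset)
  next
    case False
    with \<open>n \<notin># B\<close> show ?thesis
      by (simp add: count_ground_mset not_in_iff)
  qed
  \<comment> \<open>The restored \<open>n\<close> must also satisfy the minimum condition. Any
    \<open>k\<close> in \<open>B\<close> gives \<open>size B < k < n\<close>; for empty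
    \<open>B\<close> this is \<open>n \<ge> 1\<close>.\<close>
  moreover have "size B < n"
  proof (cases "B = {#}")
    case False
    then obtain k where "k \<in># B"
      by blast
    with B[of k] show ?thesis by linarith
  qed (use assms in simp)
  with B have "Suc (size B) \<le> Min (insert n (set_mset B))"
    by (simp add: Suc_le_eq)
  ultimately show "add_mset n B \<in> schreier_msets m n"
    by (simp add: schreier_msets_def subseteq_mset_def)
qed

lemma card_schreier_msets:
  assumes "n \<ge> 1"
  shows "card (schreier_msets m n) = card (schreier_rest m n)"
proof -
  have "schreier_msets m n = add_mset n ` schreier_rest m n"
  proof (intro equalityI subsetI)
    fix A assume "A \<in> schreier_msets m n"
    moreover from this obtain B where "A = add_mset n B"
      by (auto simp: schreier_msets_def dest: multi_member_split)
    ultimately show "A \<in> add_mset n ` schreier_rest m n"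
      using add_mset_mem_schreier_msets_iff[OF assms] by blast
  qed (use add_mset_mem_schreier_msets_iff[OF assms] in blast)
  then show ?thesis
    by (simp add: card_image inj_on_def)
qed

lemma schreier_rest_1: "schreier_rest m 1 = {{#}}"
proof -
  have "B = {#}" if "B \<in> schreier_rest m 1" for B
  proof (rule ccontr)
    assume "B \<noteq> {#}"
    then obtain k where "k \<in># B"
      by blast
    with that show False
      by (auto simp: schreier_rest_def)
  qed
  moreover have "{#} \<in> schreier_rest m 1"
    by (simp add: schreier_rest_def)
  ultimately show ?thesis
    by blast
qed

text \<open>The inverse of deleting and lowering: \<open>p\<close> stands for n - 1 and
  \<open>j\<close> for its multiplicity.\<close>

definition raise_mset :: "nat \<Rightarrow> nat \<Rightarrow> nat multiset \<Rightarrow> nat multiset" where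
  "raise_mset p j C = image_mset (\<lambda>x. x + j) C + replicate_mset j p"

lemma inj_raise_mset: "inj (raise_mset p j)"
proof (rule injI)
  fix C D assume "raise_mset p j C = raise_mset p j D"
  then have "image_mset (\<lambda>x. x + j) C = image_mset (\<lambda>x. x + j) D"
    by (simp add: raise_mset_def)
  then have "image_mset (\<lambda>x. x - j) (image_mset (\<lambda>x. x + j) C) =
             image_mset (\<lambda>x. x - j) (image_mset (\<lambda>x. x + j) D)"
    by simp
  then show "C = D"
    by (simp add: multiset.map_comp o_def)
qed

lemma count_image_mset_add:
  "count (image_mset (\<lambda>x. x + j) C) (k + j) = count C (k :: nat)"
  by (induction C) auto

text \<open>Elements of \<open>C\<close> lie below \<open>p - j\<close>, so after raising they stay
  below \<open>p\<close> and only the added copies count. Thus \<open>j\<close> can be read off from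
  the result, which makes the images for different \<open>j\<close> disjoint.\<close>

lemma count_raise_mset:
  assumes "C \<in> schreier_rest m (p - j)"
  shows "count (raise_mset p j C) p = j"
proof -
  have "p \<notin># image_mset (\<lambda>x. x + j) C"
    using assms by (auto simp: schreier_rest_def)
  then show ?thesis
    by (simp add: raise_mset_def not_in_iff del: set_image_mset)
qed

lemma raise_mset_mem_schreier_rest:
  assumes C: "C \<in> schreier_rest m (p - j)" and j: "j \<le> m" "j < p"
  shows "raise_mset p j C \<in> schreier_rest m (Suc p)"
proof -
  have C': "k < p - j \<and> count C k \<le> m \<and> size C < k" if "k \<in># C" for k
    using C that by (simp add: schreier_rest_def)
  have size: "size (raise_mset p j C) = size C + j"
    by (simp add: raise_mset_def)
  \<comment> \<open>This is the size condition for the new element \<open>p\<close>. It follows from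
    \<open>size C < k < p - j\<close> if \<open>C\<close> has an element \<open>k\<close>, and from
    \<open>j < p\<close> if \<open>C\<close> is empty.\<close>
  have "size C + j < p"
  proof (cases "C = {#}")
    case False
    then obtain k where "k \<in># C"
      by blast
    with C'[of k] show ?thesis by linarith
  qed (use j in simp)
  moreover have "k + j < Suc p \<and> count (raise_mset p j C) (k + j) \<le> m \<and> size C + j < k + j"
    if "k \<in># C" for k
    using C'[OF that] by (auto simp: raise_mset_def count_image_mset_add)
  moreover have "p < Suc p \<and> count (raise_mset p j C) p \<le> m"
    using j by (simp add: count_raise_mset[OF C])
  moreover have "x = p \<or> (\<exists>k\<in>#C. x = k + j)" if "x \<in># raise_mset p j C" for x
    using that by (auto simp: raise_mset_def split: if_splits)
  ultimately show ?thesis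
    unfolding schreier_rest_def mem_Collect_eq size by blast
qed

lemma schreier_rest_Suc_subset:
  assumes "p \<ge> 1" and B: "B \<in> schreier_rest m (Suc p)"
  shows "\<exists>j\<le>m. j < p \<and> B \<in> raise_mset p j ` schreier_rest m (p - j)"
proof -
  define j where "j = count B p"
  define R where "R = filter_mset (\<lambda>x. x \<noteq> p) B"
  define C where "C = image_mset (\<lambda>x. x - j) R"
  have B': "k \<le> p \<and> count B k \<le> m \<and> size B < k" if "k \<in># B" for k
    using B that by (auto simp: schreier_rest_def)
  have BR: "B = R + replicate_mset j p"
    by (rule multiset_eqI) (auto simp: R_def j_def)
  then have size: "size B = size C + j"
    by (simp add: C_def)
  have j: "j \<le> m" "j < p"
  proof -
    show "j \<le> m"
      using B'[of p] by (cases "p \<in># B") (auto simp: j_def not_in_iff)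
    \<comment> \<open>If \<open>p\<close> occurs in \<open>B\<close>, then
      \<open>j \<le> size B < p\<close>; otherwise \<open>j = 0\<close>, and
      \<open>p \<ge> 1\<close> suffices.\<close>
    show "j < p"
      using B'[of p] size assms(1) by (cases "p \<in># B") (auto simp: j_def not_in_iff)
  qed
  \<comment> \<open>Lowering by \<open>j\<close> loses nothing under truncated subtraction, since
    every element of \<open>B\<close> exceeds \<open>size B\<close>, which is at least
    \<open>j\<close>.\<close>
  have "image_mset (\<lambda>x. x + j) C = image_mset (\<lambda>x. x) R"
    unfolding C_def multiset.map_comp o_def
  proof (rule image_mset_cong)
    fix x assume "x \<in># R"
    then have "x \<in># B" by (simp add: R_def)
    with B'[of x] size show "x - j + j = x" by simp
  qed
  then have RC: "R = image_mset (\<lambda>x. x + j) C"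
    by simp
  have "C \<in> schreier_rest m (p - j)"
    unfolding schreier_rest_def mem_Collect_eq
  proof
    fix k assume "k \<in># C"
    then have "k + j \<in># R"
      by (auto simp: RC)
    then have "k + j \<in># B" "k + j \<noteq> p"
      by (auto simp: R_def)
    moreover have "count C k \<le> count B (k + j)"
      by (simp add: BR RC count_image_mset_add)
    ultimately show "k < p - j \<and> count C k \<le> m \<and> size C < k"
      using B'[of "k + j"] size by auto
  qed
  moreover have "B = raise_mset p j C"
    using BR RC by (simp add: raise_mset_def)
  ultimately show ?thesis
    using j by blast
qed

text \<open>The bound \<open>j < p\<close> keeps the index \<open>p - j\<close> positive. Truncation
  would turn later indices into 0, where \<open>schreier_rest\<close> still contains the empty
  multiset and would yield spurious elements.\<close>

lemma schreier_rest_Suc: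
  assumes "p \<ge> 1"
  shows "schreier_rest m (Suc p) =
    (\<Union>j\<in>{j. j \<le> m \<and> j < p}. raise_mset p j ` schreier_rest m (p - j))"
proof (intro equalityI subsetI)
  fix B assume "B \<in> schreier_rest m (Suc p)"
  from schreier_rest_Suc_subset[OF assms this]
  show "B \<in> (\<Union>j\<in>{j. j \<le> m \<and> j < p}. raise_mset p j ` schreier_rest m (p - j))"
    by blast
qed (auto intro: raise_mset_mem_schreier_rest)

lemma finite_schreier_rest: "n \<ge> 1 \<Longrightarrow> finite (schreier_rest m n)"
proof (induction n rule: less_induct)
  case (less n)
  show ?case
  proof (cases "n = 1")
    case True
    then show ?thesis by (simp only: schreier_rest_1) simp
  next
    case False
    with less.prems obtain p where "n = Suc p" "p \<ge> 1"
      by (cases n) auto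
    with less.IH show ?thesis
      by (auto simp: schreier_rest_Suc)
  qed
qed

lemma card_schreier_rest_Suc:
  assumes "p \<ge> 1"
  shows "card (schreier_rest m (Suc p)) = (\<Sum>j | j \<le> m \<and> j < p. card (schreier_rest m (p - j)))"
proof -
  have "card (schreier_rest m (Suc p)) =
      (\<Sum>j | j \<le> m \<and> j < p. card (raise_mset p j ` schreier_rest m (p - j)))"
    unfolding schreier_rest_Suc[OF assms]
  proof (rule card_UN_disjoint)
    show "\<forall>i\<in>{j. j \<le> m \<and> j < p}. \<forall>j\<in>{j. j \<le> m \<and> j < p}. i \<noteq> j \<longrightarrow>
        raise_mset p i ` schreier_rest m (p - i) \<inter> raise_mset p j ` schreier_rest m (p - j) = {}"
      \<comment> \<open>A common element would have both \<open>i\<close> and \<open>j\<close> as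
        its multiplicity of \<open>p\<close>.\<close>
      by (auto dest: arg_cong[where f = "\<lambda>B. count B p"] simp: count_raise_mset)
  qed (auto simp: finite_schreier_rest)
  then show ?thesis
    by (simp add: card_image inj_raise_mset[THEN inj_on_subset])
qed

text \<open>The multiplicities 0, ..., \<open>m\<close> give \<open>m + 1\<close> summands, hence
  the step number \<open>Suc m\<close>.\<close>

lemma card_schreier_rest: "n \<ge> 1 \<Longrightarrow> card (schreier_rest m n) = sfib (Suc m) (int n)"
proof (induction n rule: less_induct)
  case (less n)
  show ?case
  proof (cases "n = 1")
    case True
    have "card (schreier_rest m 1) = sfib (Suc m) 1"
      by (simp only: schreier_rest_1 sfib_1) simp
    with True show ?thesis by simp
  next
    case False
    with less.prems obtain p where n: "n = Suc p" and p: "p \<ge> 1"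
      by (cases n) auto
    have "card (schreier_rest m n) = (\<Sum>j | j \<le> m \<and> j < p. sfib (Suc m) (int (p - j)))"
      unfolding n card_schreier_rest_Suc[OF p] using less.IH n by (intro sum.cong) auto
    \<comment> \<open>The terms added here have \<open>j \<ge> p\<close>, so their integer index
      \<open>p - j\<close> is at most 0 and \<open>sfib\<close> vanishes: these are the zero initial
      values of the sequence.\<close>
    also have "\<dots> = (\<Sum>j\<in>{0..m}. sfib (Suc m) (int n - int (Suc j)))"
      by (rule sum.mono_neutral_cong_left) (auto simp: n sfib_nonpos of_nat_diff not_less)
    also have "\<dots> = (\<Sum>i\<in>{1..Suc m}. sfib (Suc m) (int n - int i))"
      using sum.shift_bounds_cl_Suc_ivl[of "\<lambda>i. sfib (Suc m) (int n - int i)" 0 m] by simp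
    also have "\<dots> = sfib (Suc m) (int n)"
      using n p by (intro sfib_rec[symmetric]) simp
    finally show ?thesis .
  qed
qed

theorem theorem1:
  fixes s n :: nat
  assumes "s \<ge> 2" and "n \<ge> 1"
  shows "card (schreier_msets (s - 1) n) = sfib s (int n)"
  using assms card_schreier_rest[of n "s - 1"] by (simp add: card_schreier_msets)

end
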